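(* For any $D>2$ there exist constants $\alpha,m,M,v>0$ (not depending on $n$) such that for all large enough $n$, $$\inf_{\widehat d}\ \sup_{(\Omega,\mu,W)\in\mathcal{W}_n(D,\alpha,m,M,v)}\ \mathbb{P}_{(\Omega,\mu,W)}\left[\,|\widehat d-\dim\Omega|\ge\frac{1}{2\log n}\right]\ge\frac14,$$ where the infimum is over all estimators $\widehat d$, i.e. all real-valued functions of the adjacency matrix $A\in\{0,1\}^{n\times n}$.
   Context: A graphon is a triplet $(\Omega,\mu,W)$ where $\Omega$ is a measurable space, $\mu$ a probability measure on $\Omega$ and $W:\Omega\times\Omega\to[0,1]$ a symmetric measurable function. Neighborhood distance: $r_W(\omega,\omega')=\big(\int_\Omega |W(\omega,z)-W(\omega',z)|^2\mu(dz)\big)^{1/2}$. A graphon is pure if $(\Omega,r_W)$ is a complete separable metric space and $\mu$ has full support (every ball of non-zero radius has positive measure). $B(\omega,\epsilon)$ is the $r_W$-ball with center $\omega$ and radius $\epsilon$. $N^{(c)}_\Omega(\epsilon)$ is the minimal number of closed $r_W$-balls of radius $\epsilon$ with centers in $\Omega$ needed to cover $\Omega$. The Minkowski dimension is $\dim\Omega=\lim_{\epsilon\to0}\frac{\log N^{(c)}_\Omega(\epsilon)}{-\log\epsilon}$ when the limit exists. $\mathcal{W}_n(D,\alpha,m,M,v)$ is the set of all pure graphons $(\Omega,\mu,W)$ such that $d:=\dim\Omega$ exists, $d\le D$, and for all $\epsilon\in(1/n,v]$: (i) $\alpha\epsilon^d\le\mu[B(\omega,\epsilon)]$ for all $\omega\in\Omega$;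 (ii) $m\epsilon^{-d}\le N^{(c)}_\Omega(\epsilon)\le M\epsilon^{-d}$ (with $M\ge1\ge m>0$). $W$-random graph model on $n$ nodes: $\omega_1,\dots,\omega_n$ are i.i.d. with law $\mu$ (unobserved); conditionally on them, the entries $A_{ij}$, $i<j$, are independent Bernoulli with parameters $W(\omega_i,\omega_j)$; $A_{ji}=A_{ij}$, $A_{ii}=0$. $\mathbb{P}_{(\Omega,\mu,W)}$ denotes the corresponding probability. *)

theory Defs
  imports "HOL-Probability.Probability"
begin

section \<open>Graphons and the neighborhood distance\<close>

text \<open>
  The measurable space \<open>\<Omega>\<close> and the probability measure on it are bundled in one
  object \<open>\<mu> :: 'a measure\<close>, with \<open>\<Omega> = space \<mu>\<close>. The values of \<open>W\<close> outside \<open>\<Omega> \<times> \<Omega>\<close> are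
  irrelevant.
\<close>

locale graphon = prob_space \<mu> for \<mu> :: "'a measure" +
  fixes W :: "'a \<Rightarrow> 'a \<Rightarrow> real"
  assumes measurable_W: "case_prod W \<in> borel_measurable (\<mu> \<Otimes>\<^sub>M \<mu>)"
    and W_symmetric: "\<lbrakk>x \<in> space \<mu>; y \<in> space \<mu>\<rbrakk> \<Longrightarrow> W x y = W y x"
    and W_range: "\<lbrakk>x \<in> space \<mu>; y \<in> space \<mu>\<rbrakk> \<Longrightarrow> W x y \<in> {0..1}"

definition nbhd_dist :: "'a measure \<Rightarrow> ('a \<Rightarrow> 'a \<Rightarrow> real) \<Rightarrow> 'a \<Rightarrow> 'a \<Rightarrow> real" where
  "nbhd_dist \<mu> W x y = sqrt (\<integral>z. \<bar>W x z - W y z\<bar>\<^sup>2 \<partial>\<mu>)"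

definition nbhd_ball :: "'a measure \<Rightarrow> ('a \<Rightarrow> 'a \<Rightarrow> real) \<Rightarrow> 'a \<Rightarrow> real \<Rightarrow> 'a set" where
  "nbhd_ball \<mu> W = Metric_space.mball (space \<mu>) (nbhd_dist \<mu> W)"

definition nbhd_cball :: "'a measure \<Rightarrow> ('a \<Rightarrow> 'a \<Rightarrow> real) \<Rightarrow> 'a \<Rightarrow> real \<Rightarrow> 'a set" where
  "nbhd_cball \<mu> W = Metric_space.mcball (space \<mu>) (nbhd_dist \<mu> W)"

text \<open>
  Balls are measurable for every graphon, by Fubini applied to \<open>W\<close>, so \<open>measure\<close> below is
  never applied to a non-measurable set.
\<close>

definition pure_graphon :: "'a measure \<Rightarrow> ('a \<Rightarrow> 'a \<Rightarrow> real) \<Rightarrow> bool" where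
  "pure_graphon \<mu> W \<longleftrightarrow>
     graphon \<mu> W \<and>
     Metric_space (space \<mu>) (nbhd_dist \<mu> W) \<and>
     Metric_space.mcomplete (space \<mu>) (nbhd_dist \<mu> W) \<and>
     separable_space (Metric_space.mtopology (space \<mu>) (nbhd_dist \<mu> W)) \<and>
     (\<forall>x\<in>space \<mu>. \<forall>\<epsilon>>0. measure \<mu> (nbhd_ball \<mu> W x \<epsilon>) > 0)"


section \<open>Covering numbers and Minkowski dimension\<close>

text \<open>The covering number is \<open>\<infinity>\<close> if no finite set of closed balls covers \<open>\<Omega>\<close>.\<close>

definition covering_number :: "'a measure \<Rightarrow> ('a \<Rightarrow> 'a \<Rightarrow> real) \<Rightarrow> real \<Rightarrow> enat" where
  "covering_number \<mu> W \<epsilon> =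
     (INF C\<in>{C. finite C \<and> C \<subseteq> space \<mu> \<and> space \<mu> \<subseteq> (\<Union>x\<in>C. nbhd_cball \<mu> W x \<epsilon>)}. enat (card C))"

definition dim_quotient :: "'a measure \<Rightarrow> ('a \<Rightarrow> 'a \<Rightarrow> real) \<Rightarrow> real \<Rightarrow> real" where
  "dim_quotient \<mu> W \<epsilon> = ln (real (the_enat (covering_number \<mu> W \<epsilon>))) / (- ln \<epsilon>)"

definition has_minkowski_dim :: "'a measure \<Rightarrow> ('a \<Rightarrow> 'a \<Rightarrow> real) \<Rightarrow> bool" where
  "has_minkowski_dim \<mu> W \<longleftrightarrow>
     (\<forall>\<epsilon>>0. covering_number \<mu> W \<epsilon> < \<infinity>) \<and>
     (\<exists>d. (dim_quotient \<mu> W \<longlongrightarrow> d) (at_right 0))"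

definition minkowski_dim :: "'a measure \<Rightarrow> ('a \<Rightarrow> 'a \<Rightarrow> real) \<Rightarrow> real" where
  "minkowski_dim \<mu> W = Lim (at_right 0) (dim_quotient \<mu> W)"


section \<open>The class of graphons\<close>

definition graphon_class ::
  "nat \<Rightarrow> real \<Rightarrow> real \<Rightarrow> real \<Rightarrow> real \<Rightarrow> real \<Rightarrow> ('a measure \<times> ('a \<Rightarrow> 'a \<Rightarrow> real)) set" where
  "graphon_class n D \<alpha> m M v = {(\<mu>, W).
     pure_graphon \<mu> W \<and> has_minkowski_dim \<mu> W \<and>
     (let d = minkowski_dim \<mu> W in
       d \<le> D \<and>
       (\<forall>\<epsilon>\<in>{1 / real n<..v}.
          (\<forall>x\<in>space \<mu>. \<alpha> * \<epsilon> powr d \<le> measure \<mu> (nbhd_ball \<mu> W x \<epsilon>)) \<and>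
          ereal (m * \<epsilon> powr (- d)) \<le> ereal_of_enat (covering_number \<mu> W \<epsilon>) \<and>
          ereal_of_enat (covering_number \<mu> W \<epsilon>) \<le> ereal (M * \<epsilon> powr (- d))))}"


section \<open>The W-random graph model\<close>

text \<open>
  Nodes are \<open>0, \<dots>, n - 1\<close>. A matrix in \<open>{0,1}\<^bsup>n\<times>n\<^esup>\<close> is represented as a Boolean function
  on pairs of naturals that is \<open>False\<close> outside \<open>{..<n} \<times> {..<n}\<close>. Edge variables are
  indexed by the pairs \<open>i < j\<close>; all other pairs carry the default value \<open>False\<close>, so reading
  off the entry \<open>(min i j, max i j)\<close> gives a symmetric matrix with zero diagonal.
\<close>

definition adjacency_pmf ::
  "nat \<Rightarrow> ('a \<Rightarrow> 'a \<Rightarrow> real) \<Rightarrow> (nat \<Rightarrow> 'a) \<Rightarrow> (nat \<Rightarrow> nat \<Rightarrow> bool) pmf" where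
  "adjacency_pmf n W \<omega> =
     map_pmf (\<lambda>e i j. e (min i j, max i j))
       (Pi_pmf {(i, j). i < j \<and> j < n} False (\<lambda>(i, j). bernoulli_pmf (W (\<omega> i) (\<omega> j))))"

definition W_random_graph ::
  "nat \<Rightarrow> 'a measure \<Rightarrow> ('a \<Rightarrow> 'a \<Rightarrow> real) \<Rightarrow> (nat \<Rightarrow> nat \<Rightarrow> bool) measure" where
  "W_random_graph n \<mu> W =
     Giry_Monad.bind (Pi\<^sub>M {..<n} (\<lambda>_. \<mu>)) (\<lambda>\<omega>. measure_pmf (adjacency_pmf n W \<omega>))"

text \<open>
  An estimator is an arbitrary function of the adjacency matrix. The law of the matrix is
  concentrated on the finitely many matrices supported on \<open>{..<n} \<times> {..<n}\<close>, so functions on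
  all of \<open>nat \<Rightarrow> nat \<Rightarrow> bool\<close> amount to functions on \<open>{0,1}\<^bsup>n\<times>n\<^esup>\<close>.
\<close>

type_synonym estimator = "(nat \<Rightarrow> nat \<Rightarrow> bool) \<Rightarrow> real"

text \<open>
  A complete separable metric space has at most the cardinality of the continuum, so every
  pure graphon is isomorphic (transporting \<open>\<Omega>\<close>, its \<open>\<sigma>\<close>-algebra, \<open>\<mu>\<close> and \<open>W\<close> along an
  injection) to one whose \<open>\<Omega>\<close> is a set of reals, with an arbitrary \<open>\<sigma>\<close>-algebra. The
  dimension, membership in the class and the law of the adjacency matrix are invariant under
  isomorphism; hence the supremum over all pure graphons is the supremum over those carried
  by the type \<open>real\<close>.
\<close>

type_synonym real_carried_graphon = "real measure \<times> (real \<Rightarrow> real \<Rightarrow> real)"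

end

theory Submission
  imports Defs "HOL-Real_Asymp.Real_Asymp"
begin

text \<open>
  Le Cam's two-point method. The class only constrains scales above \<open>1 / n\<close>, so a graphon of
  diameter below \<open>1 / n\<close> may have any dimension \<open>d\<close> with \<open>n powr d\<close> bounded. The one-point graphon
  with \<open>W = 0\<close> has dimension \<open>0\<close>. Against it stands an atomic graphon whose \<open>W\<close> is diagonal: if \<open>p\<close>
  is the measure and \<open>b\<close> the diagonal of \<open>W\<close>, then distinct points are at distance
  \<open>sqrt ((s x)\<^sup>2 + (s y)\<^sup>2)\<close> with \<open>s x = sqrt (p x) * b x\<close>, and the covering number at \<open>\<epsilon>\<close> is
  \<open>1 + card {x. s x > \<epsilon>}\<close>. On the natural numbers \<open>s k = c * k powr (- 1 / d)\<close> gives dimension \<open>d\<close>,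
  and \<open>d = 1 / ln n\<close> is the required separation. For \<open>c\<close> of order \<open>n powr (- 2)\<close> the
  random graph is empty with probability at least \<open>1 / 4\<close> under both graphons, and no estimate at
  the empty graph can be close to both dimensions.
\<close>

section \<open>Random graphs of countable graphons\<close>

text \<open>A singleton of a finite product is a box of singletons, and the product is countable.
  Discreteness of the product makes every map out of it measurable, as \<open>emeasure_bind\<close>
  needs below.\<close>

lemma sets_PiM_countable_discrete:
  assumes "finite I" and sets: "\<And>i. i \<in> I \<Longrightarrow> sets (M i) = Pow (space (M i))"
    and count: "\<And>i. i \<in> I \<Longrightarrow> countable (space (M i))"
  shows "sets (PiM I M) = Pow (space (PiM I M))"
proof
  show "sets (PiM I M) \<subseteq> Pow (space (PiM I M))"
    by (rule sets.space_closed)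
  have "A \<in> sets (PiM I M)" if A: "A \<subseteq> space (PiM I M)" for A
  proof (rule sets.countable)
    show "countable A"
      by (rule countable_subset[OF A]) (auto simp: space_PiM intro!: countable_PiE assms)
    fix f assume "f \<in> A"
    then have f: "f \<in> (\<Pi>\<^sub>E i\<in>I. space (M i))"
      using A by (auto simp: space_PiM)
    then have "{f} = (\<Pi>\<^sub>E i\<in>I. {f i})"
      by (metis PiE_singleton PiE_iff)
    also have "\<dots> \<in> sets (PiM I M)"
      using f by (intro sets_PiM_I_finite assms(1)) (auto simp: sets)
    finally show "{f} \<in> sets (PiM I M)" .
  qed
  then show "Pow (space (PiM I M)) \<subseteq> sets (PiM I M)"
    by auto
qed

text \<open>Given the nodes, a union bound over at most \<open>n ^ 2\<close> possible edges shows
  that the graph is empty with the claimed probability; integrating over the nodes keeps the bound.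
  \<open>S\<close> will be the error event of an estimator.\<close>

lemma W_random_graph_empty_ge:
  fixes \<delta> :: real
  assumes "graphon \<mu> W" and sets: "sets \<mu> = Pow (space \<mu>)" and count: "countable (space \<mu>)"
    and W_le: "\<And>x y. x \<in> space \<mu> \<Longrightarrow> y \<in> space \<mu> \<Longrightarrow> W x y \<le> \<delta>"
    and \<delta>: "0 \<le> \<delta>" and S: "(\<lambda>i j. False) \<in> S"
  shows "ennreal (1 - real n ^ 2 * \<delta>) \<le> emeasure (W_random_graph n \<mu> W) S"
proof -
  interpret graphon \<mu> W by fact
  let ?P = "Pi\<^sub>M {..<n} (\<lambda>_. \<mu>)"
  let ?E = "{(i, j). i < j \<and> j < n}"
  interpret P: prob_space ?P
    by (intro prob_space_PiM) unfold_locales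
  have E: "?E \<subseteq> {..<n} \<times> {..<n}"
    by auto
  have fin: "finite ?E"
    using finite_subset[OF E] by simp
  have "card ?E \<le> card ({..<n} \<times> {..<n})"
    by (rule card_mono[OF _ E]) simp
  then have card: "real (card ?E) \<le> real n ^ 2"
    by (simp add: card_cartesian_product power2_eq_square flip: of_nat_mult)
  have disc: "sets ?P = sets (count_space (space ?P))"
    using sets_PiM_countable_discrete[of "{..<n}" "\<lambda>_. \<mu>"] sets count by simp
  have meas: "(\<lambda>\<omega>. measure_pmf (adjacency_pmf n W \<omega>)) \<in> ?P \<rightarrow>\<^sub>M subprob_algebra (count_space UNIV)"
    unfolding measurable_cong_sets[OF disc refl]
    by (auto simp: space_subprob_algebra measure_pmf.subprob_space_axioms)
  have bound: "ennreal (1 - real n ^ 2 * \<delta>) \<le> emeasure (adjacency_pmf n W \<omega>) S" if \<omega>: "\<omega> \<in> space ?P" for \<omega>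
  proof -
    have in_space: "\<omega> i \<in> space \<mu>" if "i < n" for i
      using \<omega> that by (auto simp: space_PiM)
    have W01: "W (\<omega> i) (\<omega> j) \<in> {0..1}" if "(i, j) \<in> ?E" for i j
      using W_range[of "\<omega> i" "\<omega> j"] in_space that by auto
    let ?p = "Pi_pmf ?E False (\<lambda>(i, j). bernoulli_pmf (W (\<omega> i) (\<omega> j)))"
    have "1 - real n ^ 2 * \<delta> \<le> 1 - real (card ?E) * \<delta>"
      using mult_right_mono[OF card \<delta>] by simp
    also have "\<dots> \<le> 1 - (\<Sum>e\<in>?E. W (\<omega> (fst e)) (\<omega> (snd e)))"
      using sum_bounded_above[of ?E "\<lambda>e. W (\<omega> (fst e)) (\<omega> (snd e))" \<delta>]
      by (fastforce intro!: W_le in_space)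
    \<comment> \<open>The union bound, in the form of Weierstrass' product inequality.\<close>
    also have "\<dots> \<le> (\<Prod>e\<in>?E. 1 - W (\<omega> (fst e)) (\<omega> (snd e)))"
      using W01 by (intro Weierstrass_prod_ineq) fastforce
    also have "\<dots> = pmf ?p (\<lambda>_. False)"
      using W01 by (subst pmf_Pi'[OF fin]) (auto intro!: prod.cong)
    finally have "ennreal (1 - real n ^ 2 * \<delta>) \<le> ennreal (pmf ?p (\<lambda>_. False))"
      by (rule ennreal_leI)
    also have "\<dots> = emeasure ?p {\<lambda>_. False}"
      by (simp add: emeasure_pmf_single)
    also have "\<dots> \<le> emeasure ?p ((\<lambda>e i j. e (min i j, max i j)) -` S)"
      using S by (intro emeasure_mono) auto
    also have "\<dots> = emeasure (adjacency_pmf n W \<omega>) S"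
      by (simp add: adjacency_pmf_def)
    finally show ?thesis .
  qed
  have "ennreal (1 - real n ^ 2 * \<delta>) = (\<integral>\<^sup>+\<omega>. ennreal (1 - real n ^ 2 * \<delta>) \<partial>?P)"
    by (simp add: P.emeasure_space_1)
  also have "\<dots> \<le> (\<integral>\<^sup>+\<omega>. emeasure (adjacency_pmf n W \<omega>) S \<partial>?P)"
    by (intro nn_integral_mono bound)
  also have "\<dots> = emeasure (W_random_graph n \<mu> W) S"
    unfolding W_random_graph_def
    by (intro emeasure_bind[symmetric, OF _ meas]) (use P.not_empty in auto)
  finally show ?thesis .
qed

section \<open>Atomic graphons with diagonal kernel\<close>

text \<open>Cutting the space down to the support makes every point an atom, which gives full
  support at once.\<close>

definition atomic_measure :: "'a pmf \<Rightarrow> 'a measure" where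
  "atomic_measure p = restrict_space (measure_pmf p) (set_pmf p)"

definition diag_kernel :: "('a \<Rightarrow> real) \<Rightarrow> 'a \<Rightarrow> 'a \<Rightarrow> real" where
  "diag_kernel b x y = (if x = y then b x else 0)"

lemma space_atomic_measure [simp]: "space (atomic_measure p) = set_pmf p"
  by (simp add: atomic_measure_def space_restrict_space)

lemma sets_atomic_measure: "sets (atomic_measure p) = Pow (set_pmf p)"
  by (auto simp: atomic_measure_def sets_restrict_space)

lemma prob_space_atomic_measure: "prob_space (atomic_measure p)"
  unfolding atomic_measure_def
  by (rule prob_space_restrict_space) (simp_all add: measure_pmf.emeasure_eq_measure measure_pmf.prob_eq_1 AE_measure_pmf)

lemma measure_atomic_measure:
  "A \<subseteq> set_pmf p \<Longrightarrow> measure (atomic_measure p) A = measure_pmf.prob p A"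
  unfolding atomic_measure_def by (rule measure_restrict_space) auto

text \<open>The point \<open>x0\<close>, at distance \<open>s x\<close> from every \<open>x\<close>, is the limit of all non-trivial Cauchy sequences.\<close>

locale diag_graphon =
  fixes p :: "'a pmf" and b :: "'a \<Rightarrow> real" and x0 :: 'a
  assumes x0_in: "x0 \<in> set_pmf p" and b_x0: "b x0 = 0"
    and b_pos: "\<And>x. x \<in> set_pmf p \<Longrightarrow> x \<noteq> x0 \<Longrightarrow> 0 < b x"
    and b_le_1: "\<And>x. x \<in> set_pmf p \<Longrightarrow> b x \<le> 1"
begin

abbreviation "\<mu> \<equiv> atomic_measure p"
abbreviation "W \<equiv> diag_kernel b"

definition s :: "'a \<Rightarrow> real" where
  "s x = sqrt (pmf p x) * b x"

lemma s_x0 [simp]: "s x0 = 0"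
  by (simp add: s_def b_x0)

lemma b_nonneg: "x \<in> set_pmf p \<Longrightarrow> 0 \<le> b x"
  using b_pos[of x] b_x0 by (cases "x = x0") auto

lemma s_nonneg: "x \<in> set_pmf p \<Longrightarrow> 0 \<le> s x"
  by (simp add: s_def b_nonneg)

lemma s_pos: "x \<in> set_pmf p \<Longrightarrow> x \<noteq> x0 \<Longrightarrow> 0 < s x"
  by (simp add: s_def b_pos pmf_positive)

lemma graphon: "graphon \<mu> W"
proof -
  interpret prob_space \<mu> by (rule prob_space_atomic_measure)
  have "case_prod W \<in> borel_measurable (count_space (set_pmf p) \<Otimes>\<^sub>M count_space (set_pmf p))"
    by (intro measurable_pair_measure_countable1) auto
  moreover have "sets (\<mu> \<Otimes>\<^sub>M \<mu>) = sets (count_space (set_pmf p) \<Otimes>\<^sub>M count_space (set_pmf p))"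
    by (intro sets_pair_measure_cong) (simp_all add: sets_atomic_measure)
  ultimately have "case_prod W \<in> borel_measurable (\<mu> \<Otimes>\<^sub>M \<mu>)"
    by (simp cong: measurable_cong_sets)
  then show ?thesis
    by unfold_locales (auto simp: diag_kernel_def b_nonneg b_le_1)
qed

text \<open>The rows of \<open>x\<close> and \<open>y\<close> differ only at these two points, by
  \<open>b x\<close> and \<open>b y\<close>; their squares are weighted by the two masses.\<close>

lemma dist_eq:
  assumes "x \<in> set_pmf p" "y \<in> set_pmf p" "x \<noteq> y"
  shows "nbhd_dist \<mu> W x y = sqrt ((s x)\<^sup>2 + (s y)\<^sup>2)"
proof -
  interpret prob_space \<mu> by (rule prob_space_atomic_measure)
  have int: "integrable \<mu> (indicator {w} :: 'a \<Rightarrow> real)" if "w \<in> set_pmf p" for w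
    using that by (auto simp: sets_atomic_measure emeasure_eq_measure)
  have "(\<integral>z. \<bar>W x z - W y z\<bar>\<^sup>2 \<partial>\<mu>) = (\<integral>z. (b x)\<^sup>2 * indicator {x} z + (b y)\<^sup>2 * indicator {y} z \<partial>\<mu>)"
    using assms by (intro Bochner_Integration.integral_cong) (auto simp: diag_kernel_def indicator_def)
  also have "\<dots> = (b x)\<^sup>2 * measure \<mu> {x} + (b y)\<^sup>2 * measure \<mu> {y}"
    using assms by (subst Bochner_Integration.integral_add) (auto simp: int)
  also have "\<dots> = (s x)\<^sup>2 + (s y)\<^sup>2"
    using assms by (simp add: measure_atomic_measure s_def power_mult_distrib measure_pmf_single)
  finally show ?thesis
    by (simp add: nbhd_dist_def)
qed

lemma dist_self [simp]: "nbhd_dist \<mu> W x x = 0"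
  by (simp add: nbhd_dist_def)

lemma dist_x0: "x \<in> set_pmf p \<Longrightarrow> nbhd_dist \<mu> W x0 x = s x"
  using dist_eq[OF x0_in, of x] s_nonneg[of x] by (cases "x = x0") auto

lemma s_le_dist:
  assumes "x \<in> set_pmf p" "y \<in> set_pmf p" "x \<noteq> y"
  shows "s x \<le> nbhd_dist \<mu> W x y" "s y \<le> nbhd_dist \<mu> W x y"
  unfolding dist_eq[OF assms] by (auto intro: real_le_rsqrt)

lemma dist_le:
  assumes "x \<in> set_pmf p" "y \<in> set_pmf p"
  shows "nbhd_dist \<mu> W x y \<le> s x + s y"
  using assms dist_eq[OF assms] sqrt_add_le_add_sqrt[of "(s x)\<^sup>2" "(s y)\<^sup>2"]
  by (cases "x = y") (auto simp: s_nonneg)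

sublocale Metric_space "set_pmf p" "nbhd_dist \<mu> W"
proof
  show "0 \<le> nbhd_dist \<mu> W x y" for x y
    by (simp add: nbhd_dist_def)
  show "nbhd_dist \<mu> W x y = nbhd_dist \<mu> W y x" for x y
    by (simp add: nbhd_dist_def abs_minus_commute)
  show "(nbhd_dist \<mu> W x y = 0) = (x = y)" if "x \<in> set_pmf p" "y \<in> set_pmf p" for x y
    \<comment> \<open>Of two distinct points at least one is not \<open>x0\<close>, so its
      \<open>s\<close> is positive and bounds the distance from below.\<close>
    using that s_pos[of x] s_pos[of y] s_le_dist[of x y] by fastforce
  show "nbhd_dist \<mu> W x z \<le> nbhd_dist \<mu> W x y + nbhd_dist \<mu> W y z"
    if "x \<in> set_pmf p" "y \<in> set_pmf p" "z \<in> set_pmf p" for x y z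
    \<comment> \<open>If \<open>y\<close> differs from both \<open>x\<close> and \<open>z\<close>,
      the distance of \<open>x\<close> and \<open>z\<close> is at most \<open>s x + s z\<close>, and
      the two distances through \<open>y\<close> dominate \<open>s x\<close> and
      \<open>s z\<close>.\<close>
    using that dist_le[of x z] s_le_dist[of x y] s_le_dist[of y z]
    by (cases "x = y \<or> y = z") auto
qed

text \<open>A Cauchy sequence that does not tend to \<open>x0\<close> has \<open>s\<close> at least
  some fixed \<open>\<epsilon>\<close> infinitely often. A point with such an \<open>s\<close> is
  \<open>\<epsilon>\<close>-isolated, so the sequence is eventually constant.\<close>

lemma nbhd_dist_mcomplete: mcomplete
  unfolding mcomplete_def
proof (intro allI impI)
  fix \<sigma> assume "MCauchy \<sigma>"
  then have \<sigma>: "\<And>k. \<sigma> k \<in> set_pmf p"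
    and Cauchy: "\<And>\<epsilon>. 0 < \<epsilon> \<Longrightarrow> \<exists>N. \<forall>k\<ge>N. \<forall>l\<ge>N. nbhd_dist \<mu> W (\<sigma> k) (\<sigma> l) < \<epsilon>"
    by (auto simp: MCauchy_def image_subset_iff)
  show "\<exists>x. limitin mtopology \<sigma> x sequentially"
  proof (cases "limitin mtopology \<sigma> x0 sequentially")
    case False
    then obtain \<epsilon> where \<epsilon>: "0 < \<epsilon>" "\<And>N. \<exists>k\<ge>N. \<not> s (\<sigma> k) < \<epsilon>"
      using x0_in \<sigma> by (auto simp: limit_metric_sequentially commute[of _ x0] dist_x0)
    obtain N where N: "\<And>k l. N \<le> k \<Longrightarrow> N \<le> l \<Longrightarrow> nbhd_dist \<mu> W (\<sigma> k) (\<sigma> l) < \<epsilon>"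
      using Cauchy[OF \<epsilon>(1)] by auto
    obtain k where k: "N \<le> k" "\<not> s (\<sigma> k) < \<epsilon>"
      using \<epsilon>(2) by blast
    have "\<sigma> l = \<sigma> k" if "N \<le> l" for l
    proof (rule ccontr)
      assume "\<sigma> l \<noteq> \<sigma> k"
      then have "s (\<sigma> k) \<le> nbhd_dist \<mu> W (\<sigma> l) (\<sigma> k)"
        by (intro s_le_dist \<sigma>)
      with N[OF that k(1)] k(2) show False
        by simp
    qed
    then have "limitin mtopology \<sigma> (\<sigma> k) sequentially"
      using \<sigma> by (auto simp: limit_metric_sequentially intro!: exI[of _ N])
    then show ?thesis ..
  qed auto
qed

lemma pure: "pure_graphon \<mu> W"
  unfolding pure_graphon_def
proof (intro conjI ballI allI impI)
  show "separable_space (Metric_space.mtopology (space \<mu>) (nbhd_dist \<mu> W))"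
    unfolding separable_space_def
    by (rule exI[of _ "set_pmf p"]) (use closure_of_topspace[of mtopology] in simp)
  fix x and \<epsilon> :: real assume x: "x \<in> space \<mu>" "0 < \<epsilon>"
  have "0 < measure_pmf.prob p {x}"
    using x by (simp add: measure_pmf_single pmf_positive)
  also have "\<dots> \<le> measure_pmf.prob p (mball x \<epsilon>)"
    using x by (intro measure_pmf.finite_measure_mono) auto
  also have "\<dots> = measure \<mu> (nbhd_ball \<mu> W x \<epsilon>)"
    by (subst measure_atomic_measure) (auto simp: nbhd_ball_def)
  finally show "0 < measure \<mu> (nbhd_ball \<mu> W x \<epsilon>)" .
qed (use graphon Metric_space_axioms nbhd_dist_mcomplete in simp_all)

text \<open>The ball around \<open>x0\<close> covers all points with
  \<open>s x \<le> \<epsilon>\<close>. Every other point is farther than \<open>\<epsilon>\<close>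
  from all the rest and must be its own centre; covering \<open>x0\<close> takes one more centre,
  with \<open>s c \<le> \<epsilon>\<close>.\<close>

lemma covering_number:
  assumes fin: "finite {x \<in> set_pmf p. \<epsilon> < s x}" and "0 \<le> \<epsilon>"
  shows "covering_number \<mu> W \<epsilon> = enat (Suc (card {x \<in> set_pmf p. \<epsilon> < s x}))"
proof (rule antisym)
  let ?B = "{x \<in> set_pmf p. \<epsilon> < s x}"
  have "x \<in> (\<Union>c\<in>insert x0 ?B. nbhd_cball \<mu> W c \<epsilon>)" if "x \<in> set_pmf p" for x
    using that \<open>0 \<le> \<epsilon>\<close> x0_in dist_x0[of x] by (cases "\<epsilon> < s x") (auto simp: nbhd_cball_def)
  then have "covering_number \<mu> W \<epsilon> \<le> enat (card (insert x0 ?B))"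
    unfolding covering_number_def using fin x0_in by (intro INF_lower) auto
  then show "covering_number \<mu> W \<epsilon> \<le> enat (Suc (card ?B))"
    using fin \<open>0 \<le> \<epsilon>\<close> by simp
  show "enat (Suc (card ?B)) \<le> covering_number \<mu> W \<epsilon>"
    unfolding covering_number_def
  proof (rule INF_greatest, clarsimp)
    fix C assume C: "finite C" "C \<subseteq> set_pmf p" "set_pmf p \<subseteq> (\<Union>x\<in>C. nbhd_cball \<mu> W x \<epsilon>)"
    have centre: "\<exists>c\<in>C. nbhd_dist \<mu> W c x \<le> \<epsilon>" if "x \<in> set_pmf p" for x
      using C(3) that by (fastforce simp: nbhd_cball_def)
    obtain c where c: "c \<in> C" "s c \<le> \<epsilon>"
      using centre[OF x0_in] C(2) dist_x0 commute by fastforce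
    have "x \<in> C" if "x \<in> ?B" for x
      using centre[of x] that s_le_dist(2)[of _ x] C(2) by fastforce
    with c have "card (insert c ?B) \<le> card C"
      using C(1) by (intro card_mono) auto
    with fin c show "Suc (card ?B) \<le> card C"
      by simp
  qed
qed

lemma nbhd_ball_eq_space:
  assumes "\<And>x. x \<in> set_pmf p \<Longrightarrow> 2 * s x < \<epsilon>" and "x \<in> set_pmf p"
  shows "nbhd_ball \<mu> W x \<epsilon> = set_pmf p"
proof -
  have "nbhd_dist \<mu> W x y < \<epsilon>" if "y \<in> set_pmf p" for y
    using dist_le[OF assms(2) that] assms(1)[OF assms(2)] assms(1)[OF that] by simp
  then show ?thesis
    using assms(2) by (auto simp: nbhd_ball_def)
qed

text \<open>Above its diameter the graphon looks like a point, so that only the size of \<open>\<epsilon> powr d\<close> matters.\<close>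

lemma in_graphon_class:
  assumes "has_minkowski_dim \<mu> W" and d: "minkowski_dim \<mu> W = d" "0 \<le> d" "d \<le> D"
    and n: "0 < n" "real n powr d \<le> exp 1"
    and small: "\<And>x. x \<in> set_pmf p \<Longrightarrow> 2 * s x \<le> 1 / real n"
  shows "(\<mu>, W) \<in> graphon_class n D 1 (exp (- 1)) 1 1"
proof -
  have "1 * \<epsilon> powr d \<le> measure \<mu> (nbhd_ball \<mu> W x \<epsilon>) \<and>
        exp (- 1) * \<epsilon> powr - d \<le> 1 \<and> 1 \<le> 1 * \<epsilon> powr - d \<and> covering_number \<mu> W \<epsilon> = 1"
    if \<epsilon>: "\<epsilon> \<in> {1 / real n<..1}" and x: "x \<in> set_pmf p" for \<epsilon> x
  proof -
    interpret prob_space \<mu> by (rule prob_space_atomic_measure)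
    have pos: "0 < 1 / real n"
      using n by simp
    then have \<epsilon>0: "0 < \<epsilon>"
      using \<epsilon> by (meson greaterThanAtMost_iff less_trans)
    have lt: "2 * s y < \<epsilon>" if "y \<in> set_pmf p" for y
      using small[OF that] \<epsilon> by simp
    have "measure \<mu> (nbhd_ball \<mu> W x \<epsilon>) = 1"
      using nbhd_ball_eq_space[OF lt x] prob_space by simp
    moreover have "{y \<in> set_pmf p. \<epsilon> < s y} = {}"
      using lt s_nonneg by fastforce
    then have "covering_number \<mu> W \<epsilon> = 1"
      using covering_number[of \<epsilon>] \<epsilon>0
      by (metis One_nat_def card.empty finite.emptyI less_imp_le one_enat_def)
    \<comment> \<open>As the ball has mass 1 and the covering number is 1, this yields the ball
      condition with \<open>\<alpha> = 1\<close> and the upper covering bound with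
      \<open>M = 1\<close>.\<close>
    moreover have le1: "\<epsilon> powr d \<le> 1"
      using \<epsilon> \<epsilon>0 d powr_mono2[of d \<epsilon> 1] by simp
    moreover have "1 \<le> \<epsilon> powr - d"
      using le1 \<epsilon>0 by (simp add: powr_minus one_le_inverse)
    \<comment> \<open>Source of \<open>m = exp (- 1)\<close>: at scales above \<open>1 / n\<close>
      the power is at most \<open>n powr d\<close>, hence at most \<open>exp 1\<close>.\<close>
    moreover have "\<epsilon> powr - d \<le> (1 / real n) powr - d"
      using \<epsilon> pos d by (intro powr_mono2') auto
    then have "\<epsilon> powr - d \<le> exp 1"
      using n by (simp add: powr_divide powr_minus)
    then have "exp (- 1) * \<epsilon> powr - d \<le> 1"
      by (simp add: exp_minus field_simps)
    ultimately show ?thesis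
      by simp
  qed
  note * = this
  have "ereal_of_enat 1 = ereal 1"
    by (simp add: one_enat_def)
  then show ?thesis
    unfolding graphon_class_def Let_def using assms(1) pure d * x0_in
    by (auto simp del: mult_1)
qed

end

lemma minkowski_dim_eqI:
  assumes "\<And>\<epsilon>. 0 < \<epsilon> \<Longrightarrow> covering_number \<mu> W \<epsilon> < \<infinity>"
    and "(dim_quotient \<mu> W \<longlongrightarrow> d) (at_right 0)"
  shows "has_minkowski_dim \<mu> W" "minkowski_dim \<mu> W = d"
  using assms by (auto simp: has_minkowski_dim_def minkowski_dim_def intro!: tendsto_Lim)

section \<open>The two graphons\<close>

text \<open>The masses are \<open>1 / (k + 1) - 1 / (k + 2)\<close> and telescope. They decay only
  polynomially, so dividing by their square roots costs a factor linear in \<open>k\<close>.\<close>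

definition nat_pmf :: "nat pmf" where
  "nat_pmf = embed_pmf (\<lambda>k. 1 / ((real k + 1) * (real k + 2)))"

lemma pmf_nat_pmf: "pmf nat_pmf k = 1 / ((real k + 1) * (real k + 2))"
  unfolding nat_pmf_def
proof (rule pmf_embed_pmf)
  have "(\<lambda>k. 1 / (real k + 1) - 1 / (real (Suc k) + 1)) sums (1 / (real 0 + 1) - 0)"
    by (rule telescope_sums') real_asymp
  moreover have "1 / (real k + 1) - 1 / (real (Suc k) + 1) = 1 / ((real k + 1) * (real k + 2))" for k
    by (simp add: field_simps)
  ultimately have "(\<lambda>k. 1 / ((real k + 1) * (real k + 2))) sums 1"
    by simp
  then show "(\<integral>\<^sup>+k. ennreal (1 / ((real k + 1) * (real k + 2))) \<partial>count_space UNIV) = 1"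
    by (simp add: nn_integral_count_space_nat suminf_ennreal_eq sums_unique[symmetric])
qed simp

text \<open>Transport to the reals, since the theorem ranges over
  \<open>real_carried_graphon\<close>.\<close>

definition real_nat_pmf :: "real pmf" where
  "real_nat_pmf = map_pmf real nat_pmf"

lemma pmf_real_nat_pmf: "pmf real_nat_pmf (real k) = 1 / ((real k + 1) * (real k + 2))"
  by (simp add: real_nat_pmf_def pmf_map_inj' pmf_nat_pmf)

lemma set_real_nat_pmf: "set_pmf real_nat_pmf = range real"
proof -
  have "k \<in> set_pmf nat_pmf" for k
    by (simp add: set_pmf_iff pmf_nat_pmf add_nonneg_eq_0_iff)
  then have "set_pmf nat_pmf = UNIV"
    by auto
  then show ?thesis
    by (simp add: real_nat_pmf_def)
qed

text \<open>
  The square root cancels the mass of the point \<open>x\<close>. Note that \<open>0 powr a = 0\<close>, so the value at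
  \<open>0\<close> is \<open>0\<close>.
\<close>

definition decay :: "real \<Rightarrow> real \<Rightarrow> real \<Rightarrow> real" where
  "decay c d x = c * x powr (- 1 / d) * sqrt ((x + 1) * (x + 2))"

text \<open>For \<open>d \<le> 1\<close> the power is at most \<open>1 / k\<close>, which absorbs
  the linear growth of the square root, itself at most \<open>3 * k\<close>.\<close>

lemma decay_le:
  assumes "0 \<le> c" "0 < d" "d \<le> 1"
  shows "decay c d (real k) \<le> 3 * c"
proof (cases "k = 0")
  case False
  then have k: "1 \<le> real k"
    by simp
  have "sqrt ((real k + 1) * (real k + 2)) \<le> 3 * real k"
  proof (rule real_le_lsqrt)
    have "(real k + 1) * (real k + 2) \<le> (3 * real k) * (3 * real k)"
      using k by (intro mult_mono) auto
    then show "(real k + 1) * (real k + 2) \<le> (3 * real k)\<^sup>2"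
      by (simp add: power2_eq_square)
  qed (use k in auto)
  moreover have "real k powr (- 1 / d) \<le> real k powr (- 1)"
    using k assms by (intro powr_mono) (auto simp: field_simps)
  ultimately have "real k powr (- 1 / d) * sqrt ((real k + 1) * (real k + 2)) \<le> real k powr (- 1) * (3 * real k)"
    by (intro mult_mono) auto
  also have "\<dots> = 3"
    using k by (simp add: powr_minus_divide)
  finally show ?thesis
    using mult_left_mono[OF _ assms(1)] by (fastforce simp: decay_def mult_ac)
qed (use assms in \<open>simp add: decay_def\<close>)

text \<open>By \<open>decay_le\<close>, these bounds on \<open>c\<close> and \<open>d\<close> keep
  the kernel at most 1.\<close>

locale decay_graphon =
  fixes c d :: real
  assumes c: "0 < c" "3 * c \<le> 1" and d: "0 < d" "d \<le> 1"
begin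

sublocale diag_graphon real_nat_pmf "decay c d" 0
proof
  show "decay c d x \<le> 1" if "x \<in> set_pmf real_nat_pmf" for x
    using that decay_le[of c d] c d by (fastforce simp: set_real_nat_pmf intro: order_trans)
qed (use c in \<open>auto simp: set_real_nat_pmf decay_def\<close>)

lemma s_eq: "s (real k) = c * real k powr (- 1 / d)"
  by (simp add: s_def pmf_real_nat_pmf decay_def flip: real_sqrt_mult)

lemma s_le: "x \<in> set_pmf real_nat_pmf \<Longrightarrow> s x \<le> c"
proof -
  assume "x \<in> set_pmf real_nat_pmf"
  then obtain k where x: "x = real k"
    by (auto simp: set_real_nat_pmf)
  show "s x \<le> c"
  proof (cases "k = 0")
    case False
    then have "real k powr (- 1 / d) \<le> real k powr 0"
      using d by (intro powr_mono) auto
    then show ?thesis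
      using False c by (simp add: x s_eq mult_left_le)
  qed (use c x in simp)
qed

lemma s_greater_iff:
  assumes "0 < \<epsilon>"
  shows "\<epsilon> < s (real k) \<longleftrightarrow> k \<noteq> 0 \<and> real k < (c / \<epsilon>) powr d"
proof (cases "k = 0")
  case False
  have "\<epsilon> < s (real k) \<longleftrightarrow> real k powr (1 / d) < c / \<epsilon>"
    using assms False by (simp add: s_eq powr_minus field_simps)
  also have "\<dots> \<longleftrightarrow> (real k powr (1 / d)) powr d < (c / \<epsilon>) powr d"
    using assms c d by (smt (verit) divide_pos_pos powr_ge_zero powr_less_mono2)
  also have "(real k powr (1 / d)) powr d = real k"
    using False d by (simp add: powr_powr)
  finally show ?thesis
    using False by simp
qed (use assms in simp)

text \<open>With \<open>t = (c / \<epsilon>) powr d\<close>, the points having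
  \<open>s > \<epsilon>\<close> are the integers \<open>1 \<le> k < t\<close>, one fewer than the
  ceiling of \<open>t\<close>; the ball around 0 restores the missing one.\<close>

lemma covering_number_decay:
  assumes \<epsilon>: "0 < \<epsilon>"
  shows "covering_number \<mu> W \<epsilon> = enat (nat \<lceil>(c / \<epsilon>) powr d\<rceil>)"
proof -
  let ?t = "(c / \<epsilon>) powr d"
  have t: "0 < ?t"
    using c \<epsilon> by simp
  have "{x \<in> set_pmf real_nat_pmf. \<epsilon> < s x} = real ` {1..<nat \<lceil>?t\<rceil>}"
    using \<epsilon> by (auto simp: set_real_nat_pmf s_greater_iff less_ceiling_iff zless_nat_eq_int_zless)
  then have "covering_number \<mu> W \<epsilon> = enat (Suc (card (real ` {1..<nat \<lceil>?t\<rceil>})))"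
    using covering_number[of \<epsilon>] \<epsilon> by simp
  also have "card (real ` {1..<nat \<lceil>?t\<rceil>}) = nat \<lceil>?t\<rceil> - 1"
    by (simp add: card_image)
  finally show ?thesis
    using t by (simp add: Suc_nat_eq_nat_zadd1)
qed

text \<open>For \<open>\<epsilon> < c\<close> the ceiling lies between \<open>t\<close> and
  \<open>2 * t\<close>, where \<open>t = (c / \<epsilon>) powr d\<close>. The factor 2 adds only
  \<open>ln 2\<close>, which vanishes after division by \<open>- ln \<epsilon>\<close>, as does the
  contribution of \<open>c\<close>.\<close>

lemma dim: "has_minkowski_dim \<mu> W" "minkowski_dim \<mu> W = d"
proof -
  have "(dim_quotient \<mu> W \<longlongrightarrow> d) (at_right 0)"
  proof (rule tendsto_sandwich)
    have "\<forall>\<^sub>F \<epsilon> in at_right 0. \<epsilon> \<in> {0<..<c}"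
      using c by (intro eventually_at_right_real) auto
    then have "\<forall>\<^sub>F \<epsilon> in at_right 0.
        d * ln (c / \<epsilon>) / (- ln \<epsilon>) \<le> dim_quotient \<mu> W \<epsilon> \<and>
        dim_quotient \<mu> W \<epsilon> \<le> (d * ln (c / \<epsilon>) + ln 2) / (- ln \<epsilon>)"
    proof eventually_elim
      case (elim \<epsilon>)
      let ?t = "(c / \<epsilon>) powr d"
      have t: "1 \<le> ?t"
        using elim d by (intro ge_one_powr_ge_zero) auto
      have N: "?t \<le> real (nat \<lceil>?t\<rceil>)" "real (nat \<lceil>?t\<rceil>) \<le> 2 * ?t"
        using t by linarith+
      have lnt: "ln ?t = d * ln (c / \<epsilon>)"
        using elim by (simp add: ln_powr)
      have "ln ?t \<le> ln (real (nat \<lceil>?t\<rceil>))"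
        using N t by (intro ln_mono) auto
      moreover have "ln (real (nat \<lceil>?t\<rceil>)) \<le> ln (2 * ?t)"
        using N t by (intro ln_mono) auto
      moreover have "ln (2 * ?t) = ln ?t + ln 2"
        using t by (subst ln_mult) auto
      moreover have "0 < - ln \<epsilon>"
        using elim c by (simp add: ln_less_zero)
      moreover have "dim_quotient \<mu> W \<epsilon> = ln (real (nat \<lceil>?t\<rceil>)) / (- ln \<epsilon>)"
        using elim by (simp add: dim_quotient_def covering_number_decay)
      ultimately show ?case
        unfolding lnt by (simp only: divide_right_mono less_imp_le)
    qed
    then show "\<forall>\<^sub>F \<epsilon> in at_right 0. d * ln (c / \<epsilon>) / (- ln \<epsilon>) \<le> dim_quotient \<mu> W \<epsilon>"
      and "\<forall>\<^sub>F \<epsilon> in at_right 0. dim_quotient \<mu> W \<epsilon> \<le> (d * ln (c / \<epsilon>) + ln 2) / (- ln \<epsilon>)"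
      by (auto elim: eventually_mono)
    show "((\<lambda>\<epsilon>. d * ln (c / \<epsilon>) / (- ln \<epsilon>)) \<longlongrightarrow> d) (at_right 0)"
      using c d by real_asymp
    show "((\<lambda>\<epsilon>. (d * ln (c / \<epsilon>) + ln 2) / (- ln \<epsilon>)) \<longlongrightarrow> d) (at_right 0)"
      using c d by real_asymp
  qed
  then show "has_minkowski_dim \<mu> W" "minkowski_dim \<mu> W = d"
    by (intro minkowski_dim_eqI; simp add: covering_number_decay)+
qed

end

interpretation point: diag_graphon "return_pmf 0 :: real pmf" "\<lambda>_. 0" 0
  by unfold_locales auto

lemma point_dim:
  "has_minkowski_dim point.\<mu> point.W" "minkowski_dim point.\<mu> point.W = 0"
proof -
  have N: "covering_number point.\<mu> point.W \<epsilon> = 1" if "0 < \<epsilon>" for \<epsilon>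
    using point.covering_number[of \<epsilon>] that by (simp add: one_enat_def cong: conj_cong)
  have "\<forall>\<^sub>F \<epsilon> in at_right 0. dim_quotient point.\<mu> point.W \<epsilon> = 0"
    using eventually_at_right_less[of "0 :: real"]
    by eventually_elim (simp add: dim_quotient_def N one_enat_def)
  then have "(dim_quotient point.\<mu> point.W \<longlongrightarrow> 0) (at_right 0)"
    by (rule tendsto_eventually)
  then show "has_minkowski_dim point.\<mu> point.W" "minkowski_dim point.\<mu> point.W = 0"
    by (intro minkowski_dim_eqI; simp add: N one_enat_def)+
qed

section \<open>The lower bound\<close>

theorem theorem13:
  fixes D :: real
  assumes "D > 2"
  shows "\<exists>\<alpha> m M v :: real. \<alpha> > 0 \<and> 0 < m \<and> m \<le> 1 \<and> 1 \<le> M \<and> v > 0 \<and>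
    (\<forall>\<^sub>F n in sequentially.
       (INF dhat :: estimator.
          SUP (\<mu>, W) \<in> (graphon_class n D \<alpha> m M v :: real_carried_graphon set).
            emeasure (W_random_graph n \<mu> W)
              {A. \<bar>dhat A - minkowski_dim \<mu> W\<bar> \<ge> 1 / (2 * ln (real n))}) \<ge> 1 / 4)"
proof (intro exI conjI)
  show "\<forall>\<^sub>F n in sequentially.
       (INF dhat :: estimator.
          SUP (\<mu>, W) \<in> (graphon_class n D 1 (exp (- 1)) 1 1 :: real_carried_graphon set).
            emeasure (W_random_graph n \<mu> W)
              {A. \<bar>dhat A - minkowski_dim \<mu> W\<bar> \<ge> 1 / (2 * ln (real n))}) \<ge> 1 / 4"
    \<comment> \<open>From 3 on, \<open>n\<close> exceeds \<open>exp 1\<close>, so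
      \<open>ln n \<ge> 1\<close> and the dimension \<open>1 / ln n\<close> is at most 1.\<close>
    using eventually_ge_at_top[of "3 :: nat"]
  proof (rule eventually_mono, intro INF_greatest)
    fix n :: nat and dhat :: estimator
    assume n: "3 \<le> n"
    define d where "d = 1 / ln (real n)"
    \<comment> \<open>The kernel is at most \<open>3 * c\<close> by \<open>decay_le\<close>, so the
      expected number of edges is at most \<open>n ^ 2 * (3 * c) = 3 / 4\<close>, leaving
      probability \<open>1 / 4\<close> for the empty graph.\<close>
    define c where "c = 1 / (4 * real n ^ 2)"
    have "exp 1 \<le> real n"
      using n exp_le by linarith
    then have "ln (exp 1) \<le> ln (real n)"
      using n by (intro ln_mono) auto
    then have ln: "1 \<le> ln (real n)"
      by simp
    have n2: "3 * real n \<le> real n ^ 2"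
      using n by (simp add: power2_eq_square)
    \<comment> \<open>Since \<open>s x \<le> c\<close>, this puts the diameter below every scale
      that the class constrains.\<close>
    have c_le: "2 * c \<le> 1 / real n"
      using n by (simp add: c_def power2_eq_square field_simps)
    interpret decay_graphon c d
      using ln n n2 by unfold_locales (auto simp: c_def d_def field_simps)
    let ?risk = "\<lambda>g :: real_carried_graphon. case g of (N, U) \<Rightarrow> emeasure (W_random_graph n N U)
      {A. \<bar>dhat A - minkowski_dim N U\<bar> \<ge> 1 / (2 * ln (real n))}"
    have "real n powr d = exp 1"
      using n ln by (simp add: powr_def d_def)
    then have mem: "(\<mu>, W) \<in> graphon_class n D 1 (exp (- 1)) 1 1"
      using n d assms c_le s_le by (intro in_graphon_class[OF dim]) fastforce+
    have mem0: "(point.\<mu>, point.W) \<in> graphon_class n D 1 (exp (- 1)) 1 1"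
      using n assms by (intro point.in_graphon_class[OF point_dim]) auto
    have quarter: "1 / 4 = ennreal (1 - real n ^ 2 * (3 * c))"
      using n by (simp add: c_def divide_ennreal flip: ennreal_numeral ennreal_1)
    let ?A = "\<lambda>(i::nat) (j::nat). False"
    \<comment> \<open>The dimensions 0 and \<open>d\<close> are twice the tolerance apart, so the
      single value of \<open>dhat\<close> at the empty graph misses one of them; the error event of
      that graphon then contains the empty graph.\<close>
    have "1 / (2 * ln (real n)) \<le> \<bar>dhat ?A - 0\<bar> \<or> 1 / (2 * ln (real n)) \<le> \<bar>dhat ?A - d\<bar>"
    proof -
      have "d = 2 * (1 / (2 * ln (real n)))"
        by (simp add: d_def)
      then show ?thesis
        by linarith
    qed
    then show "1 / 4 \<le> (SUP g \<in> graphon_class n D 1 (exp (- 1)) 1 1. ?risk g)"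
    proof
      assume far: "1 / (2 * ln (real n)) \<le> \<bar>dhat ?A - 0\<bar>"
      have "1 / 4 \<le> ?risk (point.\<mu>, point.W)"
        unfolding quarter prod.case
        by (rule W_random_graph_empty_ge[OF point.graphon])
           (use far c in \<open>auto simp: point_dim diag_kernel_def sets_atomic_measure\<close>)
      with mem0 show ?thesis
        by (rule SUP_upper2)
    next
      assume far: "1 / (2 * ln (real n)) \<le> \<bar>dhat ?A - d\<bar>"
      have "1 / 4 \<le> ?risk (\<mu>, W)"
        unfolding quarter prod.case
        by (rule W_random_graph_empty_ge[OF graphon])
           (use far c d decay_le[of c d] in \<open>auto simp: dim diag_kernel_def sets_atomic_measure set_real_nat_pmf\<close>)
      with mem show ?thesis
        by (rule SUP_upper2)
    qed
  qed
qed auto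

end
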